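(* Let $n\ge 2$ and let $C=(C_{jkl})_{j,k,l=0}^n$ be a 3-tensor field on $\mathbb{R}^{1+n}$ such that $C\in L^1(\mathbb{R}^{1+n})$, the support of $C$ is compact, and $C_{jkl}=C_{kjl}$ for all $j,k,l=0,\ldots,n$. Let $\mathcal{O}\subset\mathbb{R}^{1+n}$ be a fixed bounded open neighborhood of the support of $C$, and suppose that $$\int C:\nabla w_1\otimes\nabla w_2\otimes\nabla w_3\,d\boldsymbol{x}=0$$ for all smooth functions $w_1,w_2,w_3$ which are harmonic on $\mathcal{O}$. Then $C=0$.
   Context: Coordinates on $\mathbb{R}^{1+n}$ are $\boldsymbol{x}=(x_0,x_1,\ldots,x_n)$ and $\nabla=(\partial_0,\partial_1,\ldots,\partial_n)$. The tensor $C$ is real-valued. The symbol "$:$" denotes contraction of tensors, so $$C:\nabla w_1\otimes\nabla w_2\otimes\nabla w_3=\sum_{j,k,l=0}^nC_{jkl}\,\partial_jw_1\,\partial_kw_2\,\partial_lw_3 .$$ "$C\in L^1$" means that every component $C_{jkl}$ is in $L^1(\mathbb{R}^{1+n})$, and $C=0$ is understood almost everywhere. *)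

theory Defs
  imports "HOL-Analysis.Analysis"
begin

definition partial_deriv :: "'n::finite \<Rightarrow> (real^'n \<Rightarrow> real) \<Rightarrow> real^'n \<Rightarrow> real" where
  "partial_deriv j w x = deriv (\<lambda>t. w (x + t *\<^sub>R axis j 1)) 0"

(* The differentiability requirement in the successor case guards against the junk values of
   deriv; it makes every iterated partial derivative below order k exist in the Frechet sense. *)
fun C_k :: "nat \<Rightarrow> (real^'n::finite \<Rightarrow> real) \<Rightarrow> bool" where
  "C_k 0 w \<longleftrightarrow> continuous_on UNIV w"
| "C_k (Suc k) w \<longleftrightarrow> (\<forall>x. w differentiable (at x)) \<and> (\<forall>j. C_k k (partial_deriv j w))"

definition smooth :: "(real^'n::finite \<Rightarrow> real) \<Rightarrow> bool" where
  "smooth w \<longleftrightarrow> (\<forall>k. C_k k w)"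

(* Meaningful for functions known to be smooth; the theorem only uses it together with smooth. *)
definition harmonic_on :: "(real^'n::finite) set \<Rightarrow> (real^'n \<Rightarrow> real) \<Rightarrow> bool" where
  "harmonic_on U w \<longleftrightarrow> (\<forall>x\<in>U. (\<Sum>j\<in>UNIV. partial_deriv j (partial_deriv j w) x) = 0)"

(* Support of an almost-everywhere equivalence class: the complement of the largest open set
   on which f vanishes almost everywhere. It does not depend on the representative f. *)
definition ess_support :: "(real^'n::finite \<Rightarrow> 'b::zero) \<Rightarrow> (real^'n) set" where
  "ess_support f = - \<Union>{V. open V \<and> (AE x in lebesgue. x \<in> V \<longrightarrow> f x = 0)}"

definition contract :: "real^'n^'n^'n::finite \<Rightarrow> real^'n \<Rightarrow> real^'n \<Rightarrow> real^'n \<Rightarrow> real" where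
  "contract T u v z = (\<Sum>j\<in>UNIV. \<Sum>k\<in>UNIV. \<Sum>l\<in>UNIV. T $ j $ k $ l * u $ j * v $ k * z $ l)"

definition grad :: "(real^'n::finite \<Rightarrow> real) \<Rightarrow> real^'n \<Rightarrow> real^'n" where
  "grad w x = (\<chi> j. partial_deriv j w x)"

end

theory Submission
  imports Defs
begin

text \<open>
  For \<open>\<zeta> \<in> \<complex>\<^sup>N\<close> with \<open>\<zeta> \<bullet> \<zeta> = 0\<close> (bilinear product) the function \<open>exp (\<zeta> \<bullet> x)\<close> is harmonic on the whole
  space, and so are its real and imaginary parts. Inserting three of them, with
  \<open>\<zeta>1 + \<zeta>2 + \<zeta>3 = \<eta>\<close> real, into the hypothesis shows that the tensor
  \<open>T = \<integral> exp (\<eta> \<bullet> x) C x dx\<close> satisfies \<open>T(\<zeta>1, \<zeta>2, \<zeta>3) = 0\<close>: this is the lemma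
  \<open>contract_Laplace_null_vectors\<close>, where the complex equation is written as two real ones.

  For \<open>\<eta> \<noteq> 0\<close> there are enough such null vectors to force \<open>T = 0\<close>. Put \<open>e = \<eta> / |\<eta>|\<close>. If \<open>x, y, z\<close> are
  linearly dependent unit vectors orthogonal to \<open>e\<close>, say \<open>a x + b y + c z = 0\<close> with nonzero
  coefficients, scaled so that \<open>a + b + c = |\<eta>|\<close>, then \<open>a (e + i x)\<close>, \<open>b (e + i y)\<close>, \<open>c (e + i z)\<close> are
  null vectors with sum \<open>\<eta>\<close>. Hence \<open>T(e + i x, e + i y, e + i z) = 0\<close>. For suitable triples the
  signs of \<open>x, y, z\<close> may be flipped independently without \<open>a + b + c\<close> becoming zero before the scaling,
  so every term in the expansion vanishes by itself. This yields
  \<open>T(e, \<cdot>, \<cdot>) = 0\<close> in every slot and makes the restriction of \<open>T\<close> to the orthogonal complement of \<open>e\<close>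
  alternating. An alternating form that is symmetric in its first two arguments is zero. This is
  \<open>contract_zero_if_null_contractions_zero\<close>; the dimension must be at least three, for otherwise
  the complement of \<open>e\<close> has no pair of orthonormal vectors.

  Thus the two-sided Laplace transform of every component of \<open>C\<close> vanishes away from the origin, and a
  compactly supported integrable function with this property is zero almost everywhere
  (\<open>AE_zero_if_Laplace_transform_zero\<close>), because by Stone--Weierstrass the real exponentials span a
  dense space of continuous functions on the support.
\<close>

section \<open>Uniqueness for the two-sided Laplace transform\<close>

text \<open>The complement of the support is an arbitrary union of open sets on which \<open>f\<close> vanishes almost
  everywhere; a countable subfamily has the same union.\<close>

lemma AE_zero_outside_ess_support:
  fixes f :: "real^'n::finite \<Rightarrow> 'b::zero"
  shows "AE x in lebesgue. x \<notin> ess_support f \<longrightarrow> f x = 0"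
proof -
  define \<V> where "\<V> = {V. open V \<and> (AE x in lebesgue. x \<in> V \<longrightarrow> f x = 0)}"
  obtain \<W> where W: "\<W> \<subseteq> \<V>" "countable \<W>" "\<Union>\<W> = \<Union>\<V>"
    using Lindelof[of \<V>] unfolding \<V>_def by blast
  have "AE x in lebesgue. \<forall>V\<in>\<W>. x \<in> V \<longrightarrow> f x = 0"
    using W(1) by (subst AE_ball_countable[OF W(2)]) (auto simp: \<V>_def)
  moreover have "ess_support f = - \<Union>\<W>"
    unfolding ess_support_def W(3) \<V>_def ..
  ultimately show ?thesis
    by (auto elim!: eventually_mono)
qed

lemma integrable_mult_continuous:
  fixes f g :: "'a::euclidean_space \<Rightarrow> real"
  assumes f: "integrable lebesgue f" and K: "compact K" "AE x in lebesgue. x \<notin> K \<longrightarrow> f x = 0"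
    and g: "continuous_on UNIV g"
  shows "integrable lebesgue (\<lambda>x. f x * g x)"
proof -
  have "compact (g ` K)"
    using K(1) g by (meson compact_continuous_image continuous_on_subset subset_UNIV)
  then obtain B where B: "\<forall>x\<in>K. norm (g x) \<le> B"
    by (auto dest!: compact_imp_bounded simp: bounded_iff)
  have gm: "g \<in> borel_measurable lebesgue"
    using continuous_imp_measurable_on_sets_lebesgue[OF g] by simp
  show ?thesis
  proof (rule Bochner_Integration.integrable_bound)
    show "integrable lebesgue (\<lambda>x. B * f x)" using f by simp
    show "(\<lambda>x. f x * g x) \<in> borel_measurable lebesgue" using f gm by measurable
    show "AE x in lebesgue. norm (f x * g x) \<le> norm (B * f x)"
      using K(2)
    proof eventually_elim
      case (elim x)
      show ?case
      proof (cases "x \<in> K")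
        case True
        then have "\<bar>g x\<bar> \<le> \<bar>B\<bar>" using B by fastforce
        then show ?thesis by (simp add: abs_mult mult.commute[of "\<bar>f x\<bar>"] mult_right_mono)
      qed (use elim in auto)
    qed
  qed
qed

text \<open>Continuous functions with values in \<open>[-1, 1]\<close> converge almost everywhere to \<open>sgn f\<close>, so the
  integrals of their products with \<open>f\<close> converge to that of \<open>\<bar>f\<bar>\<close>.\<close>

lemma AE_zero_if_continuous_integrals_zero:
  fixes f :: "'a::euclidean_space \<Rightarrow> real"
  assumes f: "integrable lebesgue f"
    and 0: "\<And>g. continuous_on UNIV g \<Longrightarrow> (LINT x|lebesgue. f x * g x) = 0"
  shows "AE x in lebesgue. f x = 0"
proof -
  have "(\<lambda>x. sgn (f x)) \<in> borel_measurable lebesgue"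
    using f by measurable
  then have "(\<lambda>x. sgn (f x)) measurable_on UNIV"
    by (rule lebesgue_measurable_imp_measurable_on_real) simp
  then obtain N g where N: "negligible N" and g: "\<And>n. continuous_on UNIV (g n)"
    and lim: "\<And>x. x \<notin> N \<Longrightarrow> (\<lambda>n. g n x) \<longlonglongrightarrow> sgn (f x)"
    unfolding measurable_on_def by auto
  define h where "h n x = max (-1) (min 1 (g n x))" for n x
  have h: "continuous_on UNIV (h n)" for n
    unfolding h_def by (intro continuous_intros g)
  have hm: "h n \<in> borel_measurable lebesgue" for n
    using continuous_imp_measurable_on_sets_lebesgue[OF h] by simp
  have AEN: "AE x in lebesgue. x \<notin> N"
    using N by (simp add: AE_not_in negligible_iff_null_sets)
  have "(\<lambda>n. LINT x|lebesgue. f x * h n x) \<longlonglongrightarrow> (LINT x|lebesgue. \<bar>f x\<bar>)"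
  proof (rule integral_dominated_convergence[where w = "\<lambda>x. \<bar>f x\<bar>"])
    show "AE x in lebesgue. (\<lambda>n. f x * h n x) \<longlonglongrightarrow> \<bar>f x\<bar>"
      using AEN
    proof eventually_elim
      case (elim x)
      have "(\<lambda>n. f x * h n x) \<longlonglongrightarrow> f x * max (-1) (min 1 (sgn (f x)))"
        unfolding h_def by (intro tendsto_intros lim[OF elim])
      also have "f x * max (-1) (min 1 (sgn (f x))) = \<bar>f x\<bar>"
        by (auto simp: sgn_if)
      finally show ?case .
    qed
    show "AE x in lebesgue. norm (f x * h n x) \<le> \<bar>f x\<bar>" for n
    proof (rule AE_I2)
      fix x
      have "\<bar>h n x\<bar> \<le> 1" by (auto simp: h_def)
      then show "norm (f x * h n x) \<le> \<bar>f x\<bar>"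
        by (simp add: abs_mult mult_left_le)
    qed
  qed (use f hm in \<open>auto intro!: Bochner_Integration.integrable_abs borel_measurable_times\<close>)
  then have "(LINT x|lebesgue. \<bar>f x\<bar>) = 0"
    using 0[OF h] by (simp add: LIMSEQ_const_iff)
  then show ?thesis
    using integral_nonneg_eq_0_iff_AE[of lebesgue "\<lambda>x. \<bar>f x\<bar>"] f by simp
qed

text \<open>Restricting the exponents to a half-space that contains the origin keeps an algebra with unit which
  separates points, and a shift of the exponents by \<open>a \<noteq> 0\<close> moves all of them into the set
  \<open>\<eta> \<noteq> 0\<close>, on which the transform is known to vanish.\<close>

inductive exp_sum :: "'a::euclidean_space \<Rightarrow> ('a \<Rightarrow> real) \<Rightarrow> bool" for a where
  exp_sum_exp: "0 \<le> \<eta> \<bullet> a \<Longrightarrow> exp_sum a (\<lambda>x. c * exp (\<eta> \<bullet> x))"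
| exp_sum_add: "exp_sum a f \<Longrightarrow> exp_sum a g \<Longrightarrow> exp_sum a (\<lambda>x. f x + g x)"

lemma exp_sum_const: "exp_sum a (\<lambda>x. c)"
  using exp_sum_exp[of 0 a c] by simp

lemma exp_sum_continuous: "exp_sum a f \<Longrightarrow> continuous_on S f"
  by (induction rule: exp_sum.induct) (auto intro!: continuous_intros)

lemma exp_sum_mult:
  assumes "exp_sum a f" "exp_sum a g"
  shows "exp_sum a (\<lambda>x. f x * g x)"
  using assms(1)
proof induction
  case (exp_sum_exp \<eta> c)
  show ?case using assms(2)
  proof induction
    case (exp_sum_exp \<theta> d)
    have "exp_sum a (\<lambda>x. (c * d) * exp ((\<eta> + \<theta>) \<bullet> x))"
      using \<open>0 \<le> \<eta> \<bullet> a\<close> exp_sum_exp by (intro exp_sum.exp_sum_exp) (simp add: inner_add_left)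
    then show ?case by (simp add: inner_add_left exp_add mult_ac)
  next
    case (exp_sum_add f g)
    from exp_sum.exp_sum_add[OF exp_sum_add.IH] show ?case by (simp add: distrib_left)
  qed
next
  case (exp_sum_add f1 f2)
  from exp_sum.exp_sum_add[OF exp_sum_add.IH] show ?case by (simp add: distrib_right)
qed

text \<open>One of \<open>x - y\<close> and \<open>y - x\<close> is an admissible exponent.\<close>

lemma exp_sum_separates:
  assumes "x \<noteq> y"
  shows "\<exists>f. exp_sum a f \<and> f x \<noteq> f y"
proof -
  obtain \<eta> where \<eta>: "0 \<le> \<eta> \<bullet> a" "\<eta> = x - y \<or> \<eta> = y - x"
    by (metis inner_minus_left le_minus_iff linear minus_diff_eq minus_zero)
  then have "\<eta> \<bullet> x \<noteq> \<eta> \<bullet> y"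
    using assms by (metis eq_iff_diff_eq_0 inner_diff_right inner_eq_zero_iff minus_diff_eq neg_equal_0_iff_equal inner_minus_right)
  then show ?thesis
    using exp_sum_exp[OF \<eta>(1), of 1] by (intro exI[of _ "\<lambda>x. 1 * exp (\<eta> \<bullet> x)"]) simp
qed

text \<open>A continuous \<open>g\<close> is uniformly close on \<open>K\<close> to \<open>p x * exp (a \<bullet> x)\<close> with \<open>p\<close> an exponential sum: apply
  Stone--Weierstrass to \<open>g x * exp (- (a \<bullet> x))\<close>. The exponents \<open>\<eta> + a\<close> occurring in the product are
  all nonzero.\<close>

lemma AE_zero_if_Laplace_transform_zero:
  fixes f :: "'a::euclidean_space \<Rightarrow> real"
  assumes f: "integrable lebesgue f" and K: "compact K" "AE x in lebesgue. x \<notin> K \<longrightarrow> f x = 0"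
    and 0: "\<And>\<eta>. \<eta> \<noteq> 0 \<Longrightarrow> (LINT x|lebesgue. f x * exp (\<eta> \<bullet> x)) = 0"
  shows "AE x in lebesgue. f x = 0"
proof (rule AE_zero_if_continuous_integrals_zero[OF f])
  fix g :: "'a \<Rightarrow> real" assume g: "continuous_on UNIV g"
  obtain a :: 'a where a: "a \<noteq> 0" using nonzero_Basis nonempty_Basis by blast
  note int = integrable_mult_continuous[OF f K]
  have *: "(LINT x|lebesgue. f x * (p x * exp (a \<bullet> x))) = 0" if "exp_sum a p" for p
    using that
  proof induction
    case (exp_sum_exp \<eta> c)
    have "(\<eta> + a) \<bullet> a > 0" using exp_sum_exp a by (simp add: inner_add_left add_nonneg_pos)
    then have "\<eta> + a \<noteq> 0" by auto
    from 0[OF this] have "(LINT x|lebesgue. c * (f x * exp ((\<eta> + a) \<bullet> x))) = 0" by simp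
    then show ?case by (simp add: inner_add_left exp_add mult_ac)
  next
    case (exp_sum_add p q)
    have "integrable lebesgue (\<lambda>x. f x * (p x * exp (a \<bullet> x)))"
         "integrable lebesgue (\<lambda>x. f x * (q x * exp (a \<bullet> x)))"
      using exp_sum_add by (auto intro!: int continuous_intros intro: exp_sum_continuous)
    then show ?case using exp_sum_add by (simp add: distrib_left distrib_right)
  qed
  define M where "M = (LINT x|lebesgue. \<bar>f x * exp (a \<bullet> x)\<bar>)"
  have M: "0 \<le> M" unfolding M_def by simp
  have bound: "\<bar>LINT x|lebesgue. f x * g x\<bar> \<le> e * M" if e: "0 < e" for e
  proof -
    have "\<exists>p. exp_sum a p \<and> (\<forall>x\<in>K. \<bar>g x * exp (- (a \<bullet> x)) - p x\<bar> < e)"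
      by (rule Stone_Weierstrass_HOL)
        (use K(1) e exp_sum_const exp_sum_continuous exp_sum_add exp_sum_mult exp_sum_separates in
          \<open>auto intro!: continuous_intros continuous_on_subset[OF g]\<close>)
    then obtain p where p: "exp_sum a p" "\<And>x. x \<in> K \<Longrightarrow> \<bar>g x * exp (- (a \<bullet> x)) - p x\<bar> < e"
      by blast
    have i1: "integrable lebesgue (\<lambda>x. f x * g x)"
      and i2: "integrable lebesgue (\<lambda>x. f x * (p x * exp (a \<bullet> x)))"
      and i3: "integrable lebesgue (\<lambda>x. f x * exp (a \<bullet> x))"
      using p(1) g by (auto intro!: int continuous_intros intro: exp_sum_continuous)
    have "(LINT x|lebesgue. f x * g x) = (LINT x|lebesgue. f x * g x - f x * (p x * exp (a \<bullet> x)))"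
      using i1 i2 *[OF p(1)] by simp
    also have "\<bar>\<dots>\<bar> \<le> (LINT x|lebesgue. \<bar>f x * g x - f x * (p x * exp (a \<bullet> x))\<bar>)"
      by (rule integral_abs_bound)
    also have "\<dots> \<le> (LINT x|lebesgue. e * \<bar>f x * exp (a \<bullet> x)\<bar>)"
    proof (rule integral_mono_AE)
      show "AE x in lebesgue. \<bar>f x * g x - f x * (p x * exp (a \<bullet> x))\<bar> \<le> e * \<bar>f x * exp (a \<bullet> x)\<bar>"
        using K(2)
      proof eventually_elim
        case (elim x)
        show ?case
        proof (cases "x \<in> K")
          case True
          have "f x * g x - f x * (p x * exp (a \<bullet> x))
              = (g x * exp (- (a \<bullet> x)) - p x) * (f x * exp (a \<bullet> x))"
            by (simp add: algebra_simps exp_minus)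
          then show ?thesis
            using p(2)[OF True] by (simp only: abs_mult[of "_ - _"]) (intro mult_right_mono, auto)
        qed (use elim in auto)
      qed
    qed (use i1 i2 i3 in \<open>auto intro!: Bochner_Integration.integrable_abs\<close>)
    also have "\<dots> = e * M" unfolding M_def by simp
    finally show ?thesis .
  qed
  show "(LINT x|lebesgue. f x * g x) = 0"
  proof (rule ccontr)
    assume nz: "(LINT x|lebesgue. f x * g x) \<noteq> 0"
    then have pos: "\<bar>LINT x|lebesgue. f x * g x\<bar> / (2 * (M + 1)) > 0" (is "?e > 0")
      using M by simp
    have "\<bar>LINT x|lebesgue. f x * g x\<bar> \<le> ?e * M" using bound[OF pos] .
    also have "\<dots> \<le> ?e * (M + 1)" using pos by (intro mult_left_mono) auto
    also have "\<dots> = \<bar>LINT x|lebesgue. f x * g x\<bar> / 2" using M by (simp add: field_simps)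
    finally show False using nz by simp
  qed
qed

section \<open>Trilinearity of the contraction\<close>

lemma contract_add_1: "contract T (u + u') v z = contract T u v z + contract T u' v z"
  and contract_add_2: "contract T u (v + v') z = contract T u v z + contract T u v' z"
  and contract_add_3: "contract T u v (z + z') = contract T u v z + contract T u v z'"
  by (simp_all add: contract_def algebra_simps sum.distrib)

lemma contract_scaleR_1: "contract T (c *\<^sub>R u) v z = c * contract T u v z"
  and contract_scaleR_2: "contract T u (c *\<^sub>R v) z = c * contract T u v z"
  and contract_scaleR_3: "contract T u v (c *\<^sub>R z) = c * contract T u v z"
  by (simp_all add: contract_def algebra_simps sum_distrib_left)

lemma contract_minus_1: "contract T (- u) v z = - contract T u v z"
  and contract_minus_2: "contract T u (- v) z = - contract T u v z"
  and contract_minus_3: "contract T u v (- z) = - contract T u v z"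
  by (simp_all add: contract_def sum_negf)

lemmas contract_simps = contract_add_1 contract_add_2 contract_add_3
  contract_scaleR_1 contract_scaleR_2 contract_scaleR_3
  contract_minus_1 contract_minus_2 contract_minus_3

lemma contract_axis: "contract T (axis j 1) (axis k 1) (axis l 1) = T $ j $ k $ l"
  by (simp add: contract_def axis_def if_distrib[of "\<lambda>c. c * _"] if_distrib[of "\<lambda>c. _ * c"] cong: if_cong)

section \<open>Harmonic exponentials\<close>

text \<open>The real part of \<open>(A - i B) exp (\<zeta> \<bullet> x)\<close> with \<open>\<zeta> = \<alpha> + i \<beta>\<close>. Keeping both coefficients makes the family
  closed under partial derivatives, which act as multiplication of \<open>A - i B\<close> by \<open>\<zeta>\<^sub>j\<close>.\<close>

definition wave :: "real^'n::finite \<Rightarrow> real^'n \<Rightarrow> real \<Rightarrow> real \<Rightarrow> real^'n \<Rightarrow> real" where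
  "wave \<alpha> \<beta> A B x = exp (\<alpha> \<bullet> x) * (A * cos (\<beta> \<bullet> x) + B * sin (\<beta> \<bullet> x))"

lemma partial_deriv_wave:
  "partial_deriv j (wave \<alpha> \<beta> A B)
    = wave \<alpha> \<beta> (A * \<alpha> $ j + B * \<beta> $ j) (B * \<alpha> $ j - A * \<beta> $ j)"
proof
  fix x
  have "((\<lambda>t. wave \<alpha> \<beta> A B (x + t *\<^sub>R axis j 1)) has_field_derivative
      wave \<alpha> \<beta> (A * \<alpha> $ j + B * \<beta> $ j) (B * \<alpha> $ j - A * \<beta> $ j) x) (at 0)"
    unfolding wave_def inner_add_right inner_scaleR_right inner_axis
    by (auto intro!: derivative_eq_intros simp: algebra_simps)
  then show "partial_deriv j (wave \<alpha> \<beta> A B) x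
      = wave \<alpha> \<beta> (A * \<alpha> $ j + B * \<beta> $ j) (B * \<alpha> $ j - A * \<beta> $ j) x"
    unfolding partial_deriv_def by (rule DERIV_imp_deriv)
qed

lemma continuous_on_wave [continuous_intros]: "continuous_on S (wave \<alpha> \<beta> A B)"
  unfolding wave_def by (intro continuous_intros)

lemma differentiable_wave: "wave \<alpha> \<beta> A B differentiable (at x)"
  unfolding wave_def differentiable_def by (rule exI) (rule derivative_eq_intros refl | simp)+

lemma smooth_wave: "smooth (wave \<alpha> \<beta> A B)"
proof -
  have "C_k k (wave \<alpha> \<beta> A B)" for k
    by (induction k arbitrary: A B)
      (auto simp: continuous_on_wave differentiable_wave partial_deriv_wave)
  then show ?thesis by (simp add: smooth_def)
qed

text \<open>The two hypotheses are the real and imaginary part of \<open>\<zeta> \<bullet> \<zeta> = 0\<close>.\<close>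

lemma harmonic_on_wave:
  assumes "\<alpha> \<bullet> \<alpha> = \<beta> \<bullet> \<beta>" and "\<alpha> \<bullet> \<beta> = 0"
  shows "harmonic_on U (wave \<alpha> \<beta> A B)"
proof -
  have "(\<Sum>j\<in>UNIV. partial_deriv j (partial_deriv j (wave \<alpha> \<beta> A B)) x)
      = wave \<alpha> \<beta> (A * (\<alpha> \<bullet> \<alpha> - \<beta> \<bullet> \<beta>) + 2 * B * (\<alpha> \<bullet> \<beta>)) (B * (\<alpha> \<bullet> \<alpha> - \<beta> \<bullet> \<beta>) - 2 * A * (\<alpha> \<bullet> \<beta>)) x" for x
    unfolding partial_deriv_wave wave_def inner_vec_def
    by (simp add: algebra_simps sum.distrib sum_subtractf sum_distrib_left sum_distrib_right)
  then show ?thesis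
    using assms by (simp add: harmonic_on_def wave_def)
qed

lemma grad_wave:
  "grad (wave \<alpha> \<beta> A B) x = wave \<alpha> \<beta> A B x *\<^sub>R \<alpha> + wave \<alpha> \<beta> B (- A) x *\<^sub>R \<beta>"
  by (simp add: grad_def partial_deriv_wave wave_def vec_eq_iff algebra_simps)

text \<open>With \<open>E = exp (\<zeta> \<bullet> x)\<close> one has \<open>P + i Q = \<nabla>E = E \<zeta>\<close>. The two identities are the real and imaginary part of
  \<open>T(\<nabla>E1, \<nabla>E2, \<nabla>E3) = E1 E2 E3 T(\<zeta>1, \<zeta>2, \<zeta>3)\<close>, where \<open>E1 E2 E3\<close> is real because the
  imaginary parts of the exponents cancel.\<close>

lemma contract_grad_waves:
  fixes \<alpha>1 \<alpha>2 \<alpha>3 \<beta>1 \<beta>2 \<beta>3 x :: "real^'n::finite"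
  assumes "\<beta>1 + \<beta>2 + \<beta>3 = 0"
  defines "P \<equiv> \<lambda>\<alpha> \<beta>. grad (wave \<alpha> \<beta> 1 0) x" and "Q \<equiv> \<lambda>\<alpha> \<beta>. grad (wave \<alpha> \<beta> 0 1) x"
  shows "contract T (P \<alpha>1 \<beta>1) (P \<alpha>2 \<beta>2) (P \<alpha>3 \<beta>3) - contract T (P \<alpha>1 \<beta>1) (Q \<alpha>2 \<beta>2) (Q \<alpha>3 \<beta>3)
      - contract T (Q \<alpha>1 \<beta>1) (P \<alpha>2 \<beta>2) (Q \<alpha>3 \<beta>3) - contract T (Q \<alpha>1 \<beta>1) (Q \<alpha>2 \<beta>2) (P \<alpha>3 \<beta>3)
    = exp ((\<alpha>1 + \<alpha>2 + \<alpha>3) \<bullet> x) * (contract T \<alpha>1 \<alpha>2 \<alpha>3 - contract T \<alpha>1 \<beta>2 \<beta>3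
        - contract T \<beta>1 \<alpha>2 \<beta>3 - contract T \<beta>1 \<beta>2 \<alpha>3)"
    and "contract T (Q \<alpha>1 \<beta>1) (P \<alpha>2 \<beta>2) (P \<alpha>3 \<beta>3) + contract T (P \<alpha>1 \<beta>1) (Q \<alpha>2 \<beta>2) (P \<alpha>3 \<beta>3)
      + contract T (P \<alpha>1 \<beta>1) (P \<alpha>2 \<beta>2) (Q \<alpha>3 \<beta>3) - contract T (Q \<alpha>1 \<beta>1) (Q \<alpha>2 \<beta>2) (Q \<alpha>3 \<beta>3)
    = exp ((\<alpha>1 + \<alpha>2 + \<alpha>3) \<bullet> x) * (contract T \<beta>1 \<alpha>2 \<alpha>3 + contract T \<alpha>1 \<beta>2 \<alpha>3
        + contract T \<alpha>1 \<alpha>2 \<beta>3 - contract T \<beta>1 \<beta>2 \<beta>3)"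
proof -
  define c s where "c \<beta> = cos (\<beta> \<bullet> x)" and "s \<beta> = sin (\<beta> \<bullet> x)" for \<beta> :: "real^'n"
  have \<beta>3: "\<beta>3 \<bullet> x = - (\<beta>1 \<bullet> x + \<beta>2 \<bullet> x)"
    using assms(1) by (metis add_eq_0_iff inner_add_left inner_minus_left)
  have c3: "c \<beta>3 = c \<beta>1 * c \<beta>2 - s \<beta>1 * s \<beta>2" and s3: "s \<beta>3 = - (s \<beta>1 * c \<beta>2 + c \<beta>1 * s \<beta>2)"
    unfolding c_def s_def \<beta>3 by (simp_all only: cos_minus sin_minus cos_add sin_add)
  have cs: "c \<beta>1 * c \<beta>1 + s \<beta>1 * s \<beta>1 = 1" "c \<beta>2 * c \<beta>2 + s \<beta>2 * s \<beta>2 = 1"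
    unfolding c_def s_def by (simp_all flip: power2_eq_square)
  \<comment> \<open>The phases \<open>c + i s\<close> of the three waves multiply to 1.\<close>
  have Re: "c \<beta>1 * c \<beta>2 * c \<beta>3 - c \<beta>1 * s \<beta>2 * s \<beta>3 - s \<beta>1 * c \<beta>2 * s \<beta>3 - s \<beta>1 * s \<beta>2 * c \<beta>3 = 1"
    and Im: "s \<beta>1 * c \<beta>2 * c \<beta>3 + c \<beta>1 * s \<beta>2 * c \<beta>3 + c \<beta>1 * c \<beta>2 * s \<beta>3 - s \<beta>1 * s \<beta>2 * s \<beta>3 = 0"
    unfolding c3 s3 using cs by (algebra, simp add: algebra_simps)
  have P: "P \<alpha> \<beta> = exp (\<alpha> \<bullet> x) *\<^sub>R (c \<beta> *\<^sub>R \<alpha> + - s \<beta> *\<^sub>R \<beta>)"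
    and Q: "Q \<alpha> \<beta> = exp (\<alpha> \<bullet> x) *\<^sub>R (s \<beta> *\<^sub>R \<alpha> + c \<beta> *\<^sub>R \<beta>)" for \<alpha> \<beta>
    unfolding P_def Q_def grad_wave by (simp_all add: wave_def c_def s_def algebra_simps)
  define E where "E = exp (\<alpha>1 \<bullet> x) * exp (\<alpha>2 \<bullet> x) * exp (\<alpha>3 \<bullet> x)"
  have E: "exp ((\<alpha>1 + \<alpha>2 + \<alpha>3) \<bullet> x) = E"
    by (simp add: E_def inner_add_left exp_add)
  show "contract T (P \<alpha>1 \<beta>1) (P \<alpha>2 \<beta>2) (P \<alpha>3 \<beta>3) - contract T (P \<alpha>1 \<beta>1) (Q \<alpha>2 \<beta>2) (Q \<alpha>3 \<beta>3)
      - contract T (Q \<alpha>1 \<beta>1) (P \<alpha>2 \<beta>2) (Q \<alpha>3 \<beta>3) - contract T (Q \<alpha>1 \<beta>1) (Q \<alpha>2 \<beta>2) (P \<alpha>3 \<beta>3)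
    = exp ((\<alpha>1 + \<alpha>2 + \<alpha>3) \<bullet> x) * (contract T \<alpha>1 \<alpha>2 \<alpha>3 - contract T \<alpha>1 \<beta>2 \<beta>3
        - contract T \<beta>1 \<alpha>2 \<beta>3 - contract T \<beta>1 \<beta>2 \<alpha>3)"
    using Re Im unfolding E E_def P Q contract_simps by algebra
  show "contract T (Q \<alpha>1 \<beta>1) (P \<alpha>2 \<beta>2) (P \<alpha>3 \<beta>3) + contract T (P \<alpha>1 \<beta>1) (Q \<alpha>2 \<beta>2) (P \<alpha>3 \<beta>3)
      + contract T (P \<alpha>1 \<beta>1) (P \<alpha>2 \<beta>2) (Q \<alpha>3 \<beta>3) - contract T (Q \<alpha>1 \<beta>1) (Q \<alpha>2 \<beta>2) (Q \<alpha>3 \<beta>3)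
    = exp ((\<alpha>1 + \<alpha>2 + \<alpha>3) \<bullet> x) * (contract T \<beta>1 \<alpha>2 \<alpha>3 + contract T \<alpha>1 \<beta>2 \<alpha>3
        + contract T \<alpha>1 \<alpha>2 \<beta>3 - contract T \<beta>1 \<beta>2 \<beta>3)"
    using Re Im unfolding E E_def P Q contract_simps by algebra
qed

section \<open>Null vectors determine the tensor\<close>

text \<open>Besides the Gram--Schmidt step, this covers \<open>y\<close> parallel to \<open>b\<close>, where \<open>c\<close> exists only because the
  dimension is at least three.\<close>

lemma orthonormal_complement_decomposition:
  fixes e b y :: "'a::euclidean_space"
  assumes dim: "DIM('a) \<ge> 3" and b: "b \<bullet> b = 1" "b \<bullet> e = 0" and y: "y \<bullet> e = 0"
  obtains c s t where "c \<bullet> c = 1" "b \<bullet> c = 0" "c \<bullet> e = 0" "y = s *\<^sub>R b + t *\<^sub>R c"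
proof -
  define d where "d = y - (y \<bullet> b) *\<^sub>R b"
  have d: "b \<bullet> d = 0" "d \<bullet> e = 0"
    using b y by (simp_all add: d_def inner_diff_left inner_diff_right inner_commute)
  show ?thesis
  proof (cases "d = 0")
    case False
    show ?thesis
      by (rule that[of "inverse (norm d) *\<^sub>R d" "y \<bullet> b" "norm d"])
        (use False d in \<open>simp_all add: d_def dot_square_norm power2_eq_square\<close>)
  next
    case True
    have "dim {b, e} \<le> card {b, e}" by (rule dim_le_card') simp
    also have "\<dots> \<le> 2" by (simp add: card_insert_if)
    finally have "dim (span {b, e}) < DIM('a)" using dim by simp
    then have "span {b, e} \<noteq> UNIV" by (metis dim_UNIV less_irrefl)
    then obtain c where c: "c \<noteq> 0" "\<And>x. x \<in> span {b, e} \<Longrightarrow> c \<bullet> x = 0"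
      using orthogonal_to_subspace_exists_gen[of "{b, e}" UNIV]
      by (auto simp: orthogonal_def psubset_eq)
    have "c \<bullet> b = 0" "c \<bullet> e = 0" using c(2) by (auto simp: span_base)
    then show ?thesis
      using True c(1) by (intro that[of "inverse (norm c) *\<^sub>R c" "y \<bullet> b" 0])
        (simp_all add: d_def dot_square_norm power2_eq_square inner_commute)
  qed
qed

text \<open>The hypotheses \<open>Re\<close> and \<open>Im\<close> are the real and imaginary part of \<open>T(e + i x, e + i y, e + i z) = 0\<close>. Since
  the coefficients of a dependency may have any signs, the triple may be replaced by
  \<open>\<plusminus>x, \<plusminus>y, \<plusminus>z\<close> as long as no signed sum of the coefficients vanishes, and averaging over the signs
  isolates each term. The dependent triple \<open>b, c, (b + c) / sqrt 2\<close> built from an orthonormal pair,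
  placed in the three slots in several orders, suffices for the conclusion.\<close>

lemma contract_zero_if_null_contractions_zero:
  fixes T :: "real^'n^'n^'n::finite" and e :: "real^'n"
  assumes dim: "CARD('n) \<ge> 3" and e: "e \<bullet> e = 1"
    and sym: "\<And>u v z. contract T u v z = contract T v u z"
    and Re: "\<And>x y z a b c. x \<bullet> x = 1 \<Longrightarrow> y \<bullet> y = 1 \<Longrightarrow> z \<bullet> z = 1 \<Longrightarrow>
          x \<bullet> e = 0 \<Longrightarrow> y \<bullet> e = 0 \<Longrightarrow> z \<bullet> e = 0 \<Longrightarrow>
          a \<noteq> 0 \<Longrightarrow> b \<noteq> 0 \<Longrightarrow> c \<noteq> 0 \<Longrightarrow> a + b + c \<noteq> 0 \<Longrightarrow> a *\<^sub>R x + b *\<^sub>R y + c *\<^sub>R z = 0 \<Longrightarrow>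
          contract T e e e - contract T e y z - contract T x e z - contract T x y e = 0"
    and Im: "\<And>x y z a b c. x \<bullet> x = 1 \<Longrightarrow> y \<bullet> y = 1 \<Longrightarrow> z \<bullet> z = 1 \<Longrightarrow>
          x \<bullet> e = 0 \<Longrightarrow> y \<bullet> e = 0 \<Longrightarrow> z \<bullet> e = 0 \<Longrightarrow>
          a \<noteq> 0 \<Longrightarrow> b \<noteq> 0 \<Longrightarrow> c \<noteq> 0 \<Longrightarrow> a + b + c \<noteq> 0 \<Longrightarrow> a *\<^sub>R x + b *\<^sub>R y + c *\<^sub>R z = 0 \<Longrightarrow>
          contract T x e e + contract T e y e + contract T e e z - contract T x y z = 0"
  shows "contract T u v z = 0"
proof -
  define \<tau> where "\<tau> = contract T"
  note simps = contract_simps[of T, folded \<tau>_def]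
  note sym = sym[folded \<tau>_def] and Re = Re[folded \<tau>_def] and Im = Im[folded \<tau>_def]
  define W where "W x \<longleftrightarrow> x \<bullet> x = 1 \<and> x \<bullet> e = 0" for x
  have signs: "\<tau> e e e = 0 \<and> \<tau> x e e = 0 \<and> \<tau> e y e = 0 \<and> \<tau> e e z = 0 \<and>
      \<tau> e y z = 0 \<and> \<tau> x e z = 0 \<and> \<tau> x y e = 0 \<and> \<tau> x y z = 0"
    if "W x" "W y" "W z" and nz: "a \<noteq> 0" "b \<noteq> 0" "c \<noteq> 0"
      and sums: "a + b + c \<noteq> 0" "a + b - c \<noteq> 0" "a - b + c \<noteq> 0" "- a + b + c \<noteq> 0"
      and dep: "a *\<^sub>R x + b *\<^sub>R y + c *\<^sub>R z = 0" for x y z a b c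
  proof -
    have W: "x \<bullet> x = 1" "y \<bullet> y = 1" "z \<bullet> z = 1" "x \<bullet> e = 0" "y \<bullet> e = 0" "z \<bullet> e = 0"
      using that unfolding W_def by auto
    have "\<tau> e e e - \<tau> e y z - \<tau> x e z - \<tau> x y e = 0"
      "\<tau> x e e + \<tau> e y e + \<tau> e e z - \<tau> x y z = 0"
      using Re[of x y z a b c] Im[of x y z a b c] W nz sums dep by auto
    moreover have "\<tau> e e e - \<tau> e y z + \<tau> x e z + \<tau> x y e = 0"
      "- \<tau> x e e + \<tau> e y e + \<tau> e e z + \<tau> x y z = 0"
      using Re[of "- x" y z "- a" b c] Im[of "- x" y z "- a" b c] W nz sums dep
      by (auto simp: simps)
    moreover have "\<tau> e e e + \<tau> e y z - \<tau> x e z + \<tau> x y e = 0"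
      "\<tau> x e e - \<tau> e y e + \<tau> e e z + \<tau> x y z = 0"
      using Re[of x "- y" z a "- b" c] Im[of x "- y" z a "- b" c] W nz sums dep
      by (auto simp: simps)
    moreover have "\<tau> e e e + \<tau> e y z + \<tau> x e z - \<tau> x y e = 0"
      "\<tau> x e e + \<tau> e y e - \<tau> e e z + \<tau> x y z = 0"
      using Re[of x y "- z" a b "- c"] Im[of x y "- z" a b "- c"] W nz sums dep
      by (auto simp: simps)
    ultimately show ?thesis by linarith
  qed
  define f where "f b c = (1 / sqrt 2) *\<^sub>R (b + c)" for b c :: "real^'n"
  have f_sum: "b + c = sqrt 2 *\<^sub>R f b c" for b c by (simp add: f_def)
  have Wf: "W (f b c)" and dep: "b + c + (- sqrt 2) *\<^sub>R f b c = 0" if "W b" "W c" "b \<bullet> c = 0" for b c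
    using that by (simp_all add: W_def f_def inner_add_left inner_add_right inner_commute)
  have Wm: "W (- b)" if "W b" for b using that by (simp add: W_def)
  have r2: "sqrt 2 \<noteq> 2" "sqrt 2 \<noteq> 0" "2 + sqrt 2 \<noteq> 0"
    using sqrt2_less_2 real_sqrt_gt_zero[of 2] by linarith+
  \<comment> \<open>The triple \<open>b, c, f b c\<close> is dependent with coefficients \<open>1, 1, - sqrt 2\<close>, whose signed sums
    \<open>\<plusminus>2 \<plusminus> sqrt 2\<close> and \<open>\<plusminus>sqrt 2\<close> do not vanish.\<close>
  have half: "\<tau> b c b + \<tau> b c c = 0 \<and> \<tau> b b c + \<tau> b c c = 0 \<and> \<tau> b b c + \<tau> c b c = 0 \<and>
      \<tau> e b c = 0 \<and> \<tau> b e c = 0 \<and> \<tau> b c e = 0 \<and>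
      \<tau> e c b + \<tau> e c c = 0 \<and> \<tau> b e b + \<tau> b e c = 0 \<and> \<tau> b b e + \<tau> b c e = 0 \<and>
      \<tau> b e e = 0 \<and> \<tau> e c e = 0 \<and> \<tau> e e c = 0 \<and> \<tau> e e e = 0"
    if bc: "W b" "W c" "b \<bullet> c = 0" for b c
  proof -
    note s1 = signs[of b c "f b c" 1 1 "- sqrt 2"]
      and s2 = signs[of b "f b c" c 1 "- sqrt 2" 1]
      and s3 = signs[of "f b c" b c "- sqrt 2" 1 1]
    have "\<tau> b c (b + c) = 0 \<and> \<tau> b (b + c) c = 0 \<and> \<tau> (b + c) b c = 0 \<and>
        \<tau> e b c = 0 \<and> \<tau> b e c = 0 \<and> \<tau> b c e = 0 \<and>
        \<tau> e c (b + c) = 0 \<and> \<tau> b e (b + c) = 0 \<and> \<tau> b (b + c) e = 0 \<and>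
        \<tau> b e e = 0 \<and> \<tau> e c e = 0 \<and> \<tau> e e c = 0 \<and> \<tau> e e e = 0"
      unfolding f_sum[of b c] simps using s1 s2 s3 bc Wf[OF bc] dep[OF bc] r2 by (simp add: algebra_simps)
    then show ?thesis by (simp add: simps)
  qed
  \<comment> \<open>Replacing \<open>c\<close> by \<open>- c\<close> separates the two terms of each sum.\<close>
  have pair: "\<tau> b c b = 0 \<and> \<tau> b c c = 0 \<and> \<tau> b b c = 0 \<and> \<tau> c b c = 0 \<and>
      \<tau> e b c = 0 \<and> \<tau> b e c = 0 \<and> \<tau> b c e = 0 \<and> \<tau> e b b = 0 \<and> \<tau> b e b = 0 \<and> \<tau> b b e = 0 \<and>
      \<tau> b e e = 0 \<and> \<tau> e b e = 0 \<and> \<tau> e e b = 0 \<and> \<tau> e e e = 0"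
    if bc: "W b" "W c" "b \<bullet> c = 0" for b c
  proof -
    have cb: "c \<bullet> b = 0" using bc by (simp add: inner_commute)
    have "\<tau> b c b - \<tau> b c c = 0 \<and> - \<tau> b b c + \<tau> b c c = 0 \<and> - \<tau> b b c + \<tau> c b c = 0"
      using half[of b "- c"] bc by (simp add: simps Wm)
    then show ?thesis
      using half[OF bc] half[OF bc(2,1) cb] by auto
  qed
  \<comment> \<open>\<open>b + c\<close> and \<open>b - c\<close> are orthogonal of equal length. The mixed terms vanish, which leaves
    \<open>\<tau> b b b = \<tau> c c c\<close>; as \<open>c\<close> may be replaced by \<open>- c\<close>, both sides are zero.\<close>
  have cube: "\<tau> b b b = 0" if bc: "W b" "W c" "b \<bullet> c = 0" for b c
  proof -
    have "\<tau> b b b = \<tau> c c c" if bc: "W b" "W c" "b \<bullet> c = 0" for b c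
    proof -
      have cb: "c \<bullet> b = 0" using bc by (simp add: inner_commute)
      have "f b c \<bullet> f b (- c) = 0"
        using bc cb by (simp add: f_def W_def algebra_simps)
      then have "\<tau> (f b c) (f b (- c)) (f b c) = 0"
        using pair[of "f b c" "f b (- c)"] Wf[OF bc] Wf[of b "- c"] bc by (simp add: Wm)
      then have "\<tau> (b + c) (b + - c) (b + c) = 0"
        unfolding f_sum[of b c] f_sum[of b "- c"] simps by simp
      then show ?thesis
        using pair[OF bc] pair[OF bc(2,1) cb] unfolding simps by simp
    qed
    from this[of b c] this[of b "- c"] bc show ?thesis by (simp add: simps Wm)
  qed
  \<comment> \<open>Scaling and the expansion of \<open>y\<close> in an orthonormal pair whose first vector is parallel to \<open>x\<close>.\<close>
  have on: "\<tau> x x y = 0 \<and> \<tau> x y x = 0 \<and> \<tau> y x x = 0 \<and> \<tau> e x y = 0 \<and> \<tau> x e y = 0 \<and> \<tau> x y e = 0 \<and>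
      \<tau> e e x = 0 \<and> \<tau> e x e = 0 \<and> \<tau> x e e = 0 \<and> \<tau> e e e = 0"
    if x: "x \<bullet> e = 0" and y: "y \<bullet> e = 0" and x0: "x \<noteq> 0" for x y
  proof -
    obtain r b where xb: "x = r *\<^sub>R b" and b: "b \<bullet> b = 1" "b \<bullet> e = 0"
    proof (rule that[of "norm x" "inverse (norm x) *\<^sub>R x"])
    qed (use x x0 in \<open>simp_all add: dot_square_norm power2_eq_square\<close>)
    obtain c s t where c: "c \<bullet> c = 1" "b \<bullet> c = 0" "c \<bullet> e = 0" and yb: "y = s *\<^sub>R b + t *\<^sub>R c"
      using orthonormal_complement_decomposition[of b e y] dim b y by auto
    have bc: "W b" "W c" "b \<bullet> c = 0" "c \<bullet> b = 0"
      using b c by (simp_all add: W_def inner_commute)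
    show ?thesis
      unfolding xb yb simps using pair[OF bc(1-3)] pair[OF bc(2,1,4)] cube[OF bc(1-3)] by simp
  qed
  have zero: "\<tau> 0 y z = 0" "\<tau> x 0 z = 0" "\<tau> x y 0 = 0" for x y z
    by (simp_all add: \<tau>_def contract_def)
  have on0: "\<tau> x x y = 0" "\<tau> x y x = 0" "\<tau> y x x = 0" "\<tau> e x y = 0" "\<tau> x e y = 0" "\<tau> x y e = 0"
      "\<tau> e e x = 0" "\<tau> e x e = 0" "\<tau> x e e = 0"
    if "x \<bullet> e = 0" "y \<bullet> e = 0" for x y
    using on[OF that] by (cases "x = 0"; simp add: zero)+
  \<comment> \<open>Polarisation gives antisymmetry in the first two arguments, against \<open>sym\<close>.\<close>
  have alt: "\<tau> x y z = 0" if "x \<bullet> e = 0" "y \<bullet> e = 0" "z \<bullet> e = 0" for x y z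
  proof -
    have "\<tau> (x + y) (x + y) z = 0" using that by (intro on0) (simp_all add: inner_add_left)
    then show ?thesis using sym[of x y z] on0 that by (simp add: simps)
  qed
  \<comment> \<open>Some nonzero vector is orthogonal to \<open>e\<close>, so \<open>on\<close> applies.\<close>
  have "\<tau> e e e = 0"
  proof -
    have "\<not> DIM(real^'n) \<le> dim {e}" using dim dim_le_card'[of "{e}"] by simp
    then have "span {e} \<noteq> UNIV" by (metis dim_span dim_UNIV order_refl)
    then obtain x where "x \<noteq> 0" "\<And>y. y \<in> span {e} \<Longrightarrow> x \<bullet> y = 0"
      using orthogonal_to_subspace_exists_gen[of "{e}" UNIV]
      by (auto simp: orthogonal_def psubset_eq)
    then show ?thesis using on[of x x] by (simp add: span_base)
  qed
  moreover have split: "\<exists>s x'. x = s *\<^sub>R e + x' \<and> x' \<bullet> e = 0" for x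
    by (rule exI[of _ "x \<bullet> e"], rule exI[of _ "x - (x \<bullet> e) *\<^sub>R e"]) (simp add: inner_diff_left e)
  obtain r s t u' v' z' where "u = r *\<^sub>R e + u'" "v = s *\<^sub>R e + v'" "z = t *\<^sub>R e + z'"
      and "u' \<bullet> e = 0" "v' \<bullet> e = 0" "z' \<bullet> e = 0"
    using split[of u] split[of v] split[of z] by metis
  ultimately have "\<tau> u v z = 0" by (simp add: simps on0 alt)
  then show ?thesis by (simp add: \<tau>_def)
qed

section \<open>The Laplace transform of the tensor field\<close>

definition Laplace :: "(real^'n \<Rightarrow> real^'n^'n^'n::finite) \<Rightarrow> real^'n \<Rightarrow> real^'n^'n^'n" where
  "Laplace C \<eta> = (\<chi> j k l. LINT x|lebesgue. C x $ j $ k $ l * exp (\<eta> \<bullet> x))"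

lemma continuous_on_grad_wave: "continuous_on S (grad (wave \<alpha> \<beta> A B))"
  unfolding grad_wave[abs_def] by (intro continuous_intros)

context
  fixes C :: "real^'n::finite \<Rightarrow> real^'n^'n^'n" and K :: "(real^'n) set"
  assumes int: "\<And>j k l. integrable lebesgue (\<lambda>x. C x $ j $ k $ l)"
    and K: "compact K" "AE x in lebesgue. x \<notin> K \<longrightarrow> C x = 0"
begin

lemma integrable_component_mult:
  "continuous_on UNIV g \<Longrightarrow> integrable lebesgue (\<lambda>x. C x $ j $ k $ l * g x)"
  by (rule integrable_mult_continuous[OF int K(1)]) (use K(2) in \<open>auto elim!: eventually_mono\<close>)

lemma integrable_contract:
  assumes "continuous_on UNIV u" "continuous_on UNIV v" "continuous_on UNIV z"
  shows "integrable lebesgue (\<lambda>x. contract (C x) (u x) (v x) (z x))"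
proof -
  have "integrable lebesgue (\<lambda>x. C x $ j $ k $ l * (u x $ j * v x $ k * z x $ l))" for j k l
    by (intro integrable_component_mult continuous_intros assms)
  then show ?thesis
    unfolding contract_def by (simp add: mult.assoc)
qed

lemma contract_Laplace:
  "contract (Laplace C \<eta>) u v z = (LINT x|lebesgue. exp (\<eta> \<bullet> x) * contract (C x) u v z)"
proof -
  have i: "integrable lebesgue (\<lambda>x. C x $ j $ k $ l * exp (\<eta> \<bullet> x))" for j k l
    by (intro integrable_component_mult continuous_intros)
  have "exp (\<eta> \<bullet> x) * contract (C x) u v z
      = (\<Sum>j\<in>UNIV. \<Sum>k\<in>UNIV. \<Sum>l\<in>UNIV. C x $ j $ k $ l * exp (\<eta> \<bullet> x) * u $ j * v $ k * z $ l)" for x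
    unfolding contract_def by (simp add: sum_distrib_left mult_ac)
  then show ?thesis
    using i by (simp add: contract_def Laplace_def)
qed

lemma contract_Laplace_commute:
  assumes "\<And>j k l. AE x in lebesgue. C x $ j $ k $ l = C x $ k $ j $ l"
  shows "contract (Laplace C \<eta>) u v z = contract (Laplace C \<eta>) v u z"
proof -
  have i: "integrable lebesgue (\<lambda>x. C x $ j $ k $ l * exp (\<eta> \<bullet> x))" for j k l
    by (intro integrable_component_mult continuous_intros)
  have "Laplace C \<eta> $ j $ k $ l = Laplace C \<eta> $ k $ j $ l" for j k l
    unfolding Laplace_def vec_lambda_beta
    by (rule integral_cong_AE) (use i assms[of j k l] in \<open>auto elim!: eventually_mono\<close>)
  then have "contract (Laplace C \<eta>) u v z
      = (\<Sum>j\<in>UNIV. \<Sum>k\<in>UNIV. \<Sum>l\<in>UNIV. Laplace C \<eta> $ k $ j $ l * v $ k * u $ j * z $ l)"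
    unfolding contract_def by (intro sum.cong refl) (simp add: mult_ac)
  also have "\<dots> = contract (Laplace C \<eta>) v u z"
    unfolding contract_def by (rule sum.swap)
  finally show ?thesis .
qed

text \<open>The vectors \<open>\<alpha> + i \<beta>\<close> are null and sum to the real vector \<open>\<eta>\<close>; the conclusions are the real and imaginary
  part of \<open>\<tau>(\<zeta>1, \<zeta>2, \<zeta>3) = 0\<close>. Each of the integrals combined here is zero by hypothesis, since real and
  imaginary parts of the exponentials are harmonic everywhere.\<close>

lemma contract_Laplace_null_vectors:
  assumes waves: "\<And>w1 w2 w3. smooth w1 \<Longrightarrow> smooth w2 \<Longrightarrow> smooth w3 \<Longrightarrow>
           harmonic_on U w1 \<Longrightarrow> harmonic_on U w2 \<Longrightarrow> harmonic_on U w3 \<Longrightarrow>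
           (LINT x|lebesgue. contract (C x) (grad w1 x) (grad w2 x) (grad w3 x)) = 0"
    and null: "\<alpha>1 \<bullet> \<alpha>1 = \<beta>1 \<bullet> \<beta>1" "\<alpha>1 \<bullet> \<beta>1 = 0" "\<alpha>2 \<bullet> \<alpha>2 = \<beta>2 \<bullet> \<beta>2" "\<alpha>2 \<bullet> \<beta>2 = 0"
      "\<alpha>3 \<bullet> \<alpha>3 = \<beta>3 \<bullet> \<beta>3" "\<alpha>3 \<bullet> \<beta>3 = 0"
    and sums: "\<alpha>1 + \<alpha>2 + \<alpha>3 = \<eta>" "\<beta>1 + \<beta>2 + \<beta>3 = 0"
  defines "\<tau> \<equiv> contract (Laplace C \<eta>)"
  shows "\<tau> \<alpha>1 \<alpha>2 \<alpha>3 - \<tau> \<alpha>1 \<beta>2 \<beta>3 - \<tau> \<beta>1 \<alpha>2 \<beta>3 - \<tau> \<beta>1 \<beta>2 \<alpha>3 = 0"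
    and "\<tau> \<beta>1 \<alpha>2 \<alpha>3 + \<tau> \<alpha>1 \<beta>2 \<alpha>3 + \<tau> \<alpha>1 \<alpha>2 \<beta>3 - \<tau> \<beta>1 \<beta>2 \<beta>3 = 0"
proof -
  define D where "D A1 B1 A2 B2 A3 B3 x = contract (C x) (grad (wave \<alpha>1 \<beta>1 A1 B1) x)
      (grad (wave \<alpha>2 \<beta>2 A2 B2) x) (grad (wave \<alpha>3 \<beta>3 A3 B3) x)" for A1 B1 A2 B2 A3 B3 x
  have D0: "(LINT x|lebesgue. D A1 B1 A2 B2 A3 B3 x) = 0" for A1 B1 A2 B2 A3 B3
    unfolding D_def by (intro waves smooth_wave harmonic_on_wave null)
  have Di [simp]: "integrable lebesgue (D A1 B1 A2 B2 A3 B3)" for A1 B1 A2 B2 A3 B3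
    unfolding D_def[abs_def] by (intro integrable_contract continuous_on_grad_wave)
  have Ci [simp]: "integrable lebesgue (\<lambda>x. exp (\<eta> \<bullet> x) * contract (C x) u v z)" for u v z
  proof -
    have "integrable lebesgue (\<lambda>x. contract (C x) (exp (\<eta> \<bullet> x) *\<^sub>R u) v z)"
      by (intro integrable_contract continuous_intros)
    then show ?thesis by (simp add: contract_simps)
  qed
  have Re: "D 1 0 1 0 1 0 x - D 1 0 0 1 0 1 x - D 0 1 1 0 0 1 x - D 0 1 0 1 1 0 x
      = exp (\<eta> \<bullet> x) * (contract (C x) \<alpha>1 \<alpha>2 \<alpha>3 - contract (C x) \<alpha>1 \<beta>2 \<beta>3
        - contract (C x) \<beta>1 \<alpha>2 \<beta>3 - contract (C x) \<beta>1 \<beta>2 \<alpha>3)"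
    and Im: "D 0 1 1 0 1 0 x + D 1 0 0 1 1 0 x + D 1 0 1 0 0 1 x - D 0 1 0 1 0 1 x
      = exp (\<eta> \<bullet> x) * (contract (C x) \<beta>1 \<alpha>2 \<alpha>3 + contract (C x) \<alpha>1 \<beta>2 \<alpha>3
        + contract (C x) \<alpha>1 \<alpha>2 \<beta>3 - contract (C x) \<beta>1 \<beta>2 \<beta>3)" for x
    unfolding D_def using contract_grad_waves[OF sums(2), of "C x"] sums(1) by simp_all
  have "\<tau> \<alpha>1 \<alpha>2 \<alpha>3 - \<tau> \<alpha>1 \<beta>2 \<beta>3 - \<tau> \<beta>1 \<alpha>2 \<beta>3 - \<tau> \<beta>1 \<beta>2 \<alpha>3
      = (LINT x|lebesgue. D 1 0 1 0 1 0 x - D 1 0 0 1 0 1 x - D 0 1 1 0 0 1 x - D 0 1 0 1 1 0 x)"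
    unfolding \<tau>_def contract_Laplace Re by (simp add: right_diff_distrib)
  also have "\<dots> = 0" by (simp add: D0)
  finally show "\<tau> \<alpha>1 \<alpha>2 \<alpha>3 - \<tau> \<alpha>1 \<beta>2 \<beta>3 - \<tau> \<beta>1 \<alpha>2 \<beta>3 - \<tau> \<beta>1 \<beta>2 \<alpha>3 = 0" .
  have "\<tau> \<beta>1 \<alpha>2 \<alpha>3 + \<tau> \<alpha>1 \<beta>2 \<alpha>3 + \<tau> \<alpha>1 \<alpha>2 \<beta>3 - \<tau> \<beta>1 \<beta>2 \<beta>3
      = (LINT x|lebesgue. D 0 1 1 0 1 0 x + D 1 0 0 1 1 0 x + D 1 0 1 0 0 1 x - D 0 1 0 1 0 1 x)"
    unfolding \<tau>_def contract_Laplace Im by (simp add: right_diff_distrib distrib_left)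
  also have "\<dots> = 0" by (simp add: D0)
  finally show "\<tau> \<beta>1 \<alpha>2 \<alpha>3 + \<tau> \<alpha>1 \<beta>2 \<alpha>3 + \<tau> \<alpha>1 \<alpha>2 \<beta>3 - \<tau> \<beta>1 \<beta>2 \<beta>3 = 0" .
qed

end

section \<open>Vanishing of the tensor field\<close>

theorem theorem2:
  fixes n :: nat
    and C :: "real^'n::finite \<Rightarrow> real^'n^'n^'n"
    and U :: "(real^'n) set"
  assumes "n \<ge> 2" and "CARD('n) = 1 + n"
    and "\<And>j k l. integrable lebesgue (\<lambda>x. C x $ j $ k $ l)"
    and "compact (ess_support C)"
    and "\<And>j k l. AE x in lebesgue. C x $ j $ k $ l = C x $ k $ j $ l"
    and "open U" and "bounded U" and "ess_support C \<subseteq> U"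
    and "\<And>w1 w2 w3. smooth w1 \<Longrightarrow> smooth w2 \<Longrightarrow> smooth w3 \<Longrightarrow>
           harmonic_on U w1 \<Longrightarrow> harmonic_on U w2 \<Longrightarrow> harmonic_on U w3 \<Longrightarrow>
           (LINT x|lebesgue. contract (C x) (grad w1 x) (grad w2 x) (grad w3 x)) = 0"
  shows "AE x in lebesgue. C x = 0"
proof -
  note supp = assms(3,4) AE_zero_outside_ess_support[of C]
  have transform: "contract (Laplace C \<eta>) u v z = 0" if "\<eta> \<noteq> 0" for \<eta> u v z
  proof -
    define e where "e = inverse (norm \<eta>) *\<^sub>R \<eta>"
    have \<eta>: "norm \<eta> *\<^sub>R e = \<eta>" and e: "e \<bullet> e = 1"
      using that by (simp_all add: e_def dot_square_norm power2_eq_square)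
    define \<tau> where "\<tau> = contract (Laplace C \<eta>)"
    have "\<tau> e e e - \<tau> e y z - \<tau> x e z - \<tau> x y e = 0 \<and> \<tau> x e e + \<tau> e y e + \<tau> e e z - \<tau> x y z = 0"
      if xyz: "x \<bullet> x = 1" "y \<bullet> y = 1" "z \<bullet> z = 1" "x \<bullet> e = 0" "y \<bullet> e = 0" "z \<bullet> e = 0"
        and nz: "a \<noteq> 0" "b \<noteq> 0" "c \<noteq> 0" "a + b + c \<noteq> 0"
        and dep: "a *\<^sub>R x + b *\<^sub>R y + c *\<^sub>R z = 0" for x y z a b c
    proof -
      \<comment> \<open>After this scaling the null vectors \<open>s a (e + i x)\<close>, \<open>s b (e + i y)\<close>, \<open>s c (e + i z)\<close> sum to \<open>\<eta>\<close>.\<close>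
      define s where "s = norm \<eta> / (a + b + c)"
      have s0: "s \<noteq> 0" and "s * (a + b + c) = norm \<eta>"
        using nz \<open>\<eta> \<noteq> 0\<close> by (simp_all add: s_def)
      then have s: "s * a + s * b + s * c = norm \<eta>"
        by (simp only: distrib_left)
      have \<alpha>: "(s * a) *\<^sub>R e + (s * b) *\<^sub>R e + (s * c) *\<^sub>R e = \<eta>"
        by (simp only: s \<eta> flip: scaleR_add_left)
      have "s *\<^sub>R (a *\<^sub>R x + b *\<^sub>R y + c *\<^sub>R z) = 0"
        by (simp only: dep scaleR_zero_right)
      then have \<beta>: "(s * a) *\<^sub>R x + (s * b) *\<^sub>R y + (s * c) *\<^sub>R z = 0"
        by (simp only: scaleR_add_right scaleR_scaleR)
      have N: "(t *\<^sub>R e) \<bullet> (t *\<^sub>R e) = (t *\<^sub>R w) \<bullet> (t *\<^sub>R w)" "(t *\<^sub>R e) \<bullet> (t *\<^sub>R w) = 0"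
        if "w \<bullet> w = 1" "w \<bullet> e = 0" for t w
        using that e by (simp_all add: inner_commute)
      note null = contract_Laplace_null_vectors[OF supp assms(9) N[OF xyz(1,4)] N[OF xyz(2,5)]
          N[OF xyz(3,6)] \<alpha> \<beta>, folded \<tau>_def]
      have "s * a * (s * b) * (s * c) * (\<tau> e e e - \<tau> e y z - \<tau> x e z - \<tau> x y e) = 0"
        "s * a * (s * b) * (s * c) * (\<tau> x e e + \<tau> e y e + \<tau> e e z - \<tau> x y z) = 0"
        using null unfolding \<tau>_def contract_simps by (simp_all only: algebra_simps)
      then show ?thesis using nz s0 by simp
    qed
    note null = this
    show ?thesis
      unfolding \<tau>_def[symmetric]
    proof (rule contract_zero_if_null_contractions_zero[where T = "Laplace C \<eta>", folded \<tau>_def])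
      show "CARD('n) \<ge> 3" using assms(1,2) by simp
      show "\<tau> u v z = \<tau> v u z" for u v z
        unfolding \<tau>_def by (rule contract_Laplace_commute[OF supp assms(5)])
    qed (use null in \<open>blast intro: e\<close>)+
  qed
  have "AE x in lebesgue. C x $ j $ k $ l = 0" for j k l
  proof (rule AE_zero_if_Laplace_transform_zero[OF assms(3,4)])
    show "AE x in lebesgue. x \<notin> ess_support C \<longrightarrow> C x $ j $ k $ l = 0"
      using supp(3) by (auto elim!: eventually_mono)
    show "(LINT x|lebesgue. C x $ j $ k $ l * exp (\<eta> \<bullet> x)) = 0" if "\<eta> \<noteq> 0" for \<eta>
      using transform[OF that, of "axis j 1" "axis k 1" "axis l 1"]
      by (simp add: contract_axis Laplace_def)
  qed
  then have "AE x in lebesgue. \<forall>j k l. C x $ j $ k $ l = 0"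
    by (simp only: AE_all_countable) simp
  then show ?thesis
    by (simp add: vec_eq_iff)
qed

end
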